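(* For any integers $n\geq i\geq 0$, there holds $$U_{n,i}=\sum_{j=0}^{n-i}(-1)^{j}\sum_{m=0}^{n-i-j}\binom{n+m+i-j+2}{n-i-j-m}C_{m}^{(2i+3)},$$ where $C_{m}^{(k)}=\frac{k}{m+k}\binom{2m+k}{m}$. Moreover, $U_{n,i}$ is the $(n,i)$-entry of the Riordan array $$\Big(\frac{S(x)^3}{1+x},\ xS(x)^2\Big).$$
   Context: A G-Motzkin path of length $n$ is a lattice path from $(0,0)$ to $(n,0)$ in the first quadrant (never going below the $x$-axis) consisting of up steps $\mathbf{u}=(1,1)$, down steps $\mathbf{d}=(1,-1)$, horizontal steps $\mathbf{h}=(1,0)$ and vertical steps $\mathbf{v}=(0,-1)$. It is $\mathbf{uvu}$-avoiding if it contains no three consecutive steps $\mathbf{u},\mathbf{v},\mathbf{u}$. $\mathcal{G}_{n}^{\mathbf{uvu}}$ is the set of all (unweighted) $\mathbf{uvu}$-avoiding G-Motzkin paths of length $n$. A step is at level $\ell$ if the ordinate of its endpoint is $\ell$. $U_{n,i}$ is the total number of $\mathbf{u}$-steps at level $i+1$ in all paths $\mathbf{G}\in\mathcal{G}_{n+1}^{\mathbf{uvu}}$. $S(x)=\frac{1-x-\sqrt{1-6x+x^2}}{2x}$ is the generating function of the large Schröder numbers. For formal power series $d(x),h(x)$ with $d(0)=1$, $h(0)=0$, the Riordan array $(d(x),h(x))$ is the infinite lower triangular matrix $(d_{n,i})_{n,i\ge 0}$ with $d_{n,i}=[x^n]\,d(x)h(x)^i$, where $[x^n]$ denotes the coefficient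 of $x^n$.
   Formalization: The formula for C_m^{(k)} is corrected to k/(2m+k)·binom(2m+k,m); with the printed prefactor k/(m+k) the first identity fails, e.g. for n=1, i=0 the sum is 23/4 while U_{1,0}=5. *)

theory Defs
  imports
    Complex_Main
    "HOL-Library.Sublist"
    "HOL-Library.Product_Plus"
    "HOL-Computational_Algebra.Formal_Power_Series"
begin

unbundle fps_syntax

subsection \<open>G-Motzkin paths\<close>

datatype step = Up | Down | Horiz | Vert

fun step_vec :: "step \<Rightarrow> int \<times> int" where
  "step_vec Up = (1, 1)"
| "step_vec Down = (1, -1)"
| "step_vec Horiz = (1, 0)"
| "step_vec Vert = (0, -1)"

text \<open>A path is the list of its steps; it always starts at the origin.\<close>

definition endpoint :: "step list \<Rightarrow> int \<times> int" where
  "endpoint p = sum_list (map step_vec p)"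

definition G_Motzkin_path :: "nat \<Rightarrow> step list \<Rightarrow> bool" where
  "G_Motzkin_path n p \<longleftrightarrow>
     endpoint p = (int n, 0) \<and>
     (\<forall>k\<le>length p. 0 \<le> fst (endpoint (take k p)) \<and> 0 \<le> snd (endpoint (take k p)))"

text \<open>\<^const>\<open>sublist\<close> means contiguous sublist.\<close>

definition uvu_avoiding :: "step list \<Rightarrow> bool" where
  "uvu_avoiding p \<longleftrightarrow> \<not> sublist [Up, Vert, Up] p"

definition G_uvu :: "nat \<Rightarrow> step list set" where
  "G_uvu n = {p. G_Motzkin_path n p \<and> uvu_avoiding p}"

text \<open>The \<open>k\<close>-th step (counted from \<open>0\<close>) ends at \<open>endpoint (take (Suc k) p)\<close>.\<close>

definition u_steps_at_level :: "int \<Rightarrow> step list \<Rightarrow> nat set" where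
  "u_steps_at_level l p =
     {k. k < length p \<and> p ! k = Up \<and> snd (endpoint (take (Suc k) p)) = l}"

definition U :: "nat \<Rightarrow> nat \<Rightarrow> nat" where
  "U n i = (\<Sum>p\<in>G_uvu (n + 1). card (u_steps_at_level (int i + 1) p))"

text \<open>The sum defining \<^const>\<open>U\<close> is over a finite set, so it does not degenerate to \<open>0\<close>.\<close>

lemma length_le_endpoint: "int (length p) \<le> 2 * fst (endpoint p) - snd (endpoint p)"
proof (induction p)
  case Nil
  then show ?case by (simp add: endpoint_def zero_prod_def)
next
  case (Cons a p)
  then show ?case by (cases a) (auto simp: endpoint_def)
qed

instance step :: finite
proof
  have "(UNIV :: step set) \<subseteq> {Up, Down, Horiz, Vert}"
    using step.exhaust by blast
  then show "finite (UNIV :: step set)" by (rule finite_subset) simp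
qed

lemma finite_G_uvu: "finite (G_uvu n)"
proof -
  have "G_uvu n \<subseteq> {p. set p \<subseteq> UNIV \<and> length p \<le> 2 * n}"
  proof
    fix p assume "p \<in> G_uvu n"
    then have "endpoint p = (int n, 0)" by (simp add: G_uvu_def G_Motzkin_path_def)
    then show "p \<in> {p. set p \<subseteq> UNIV \<and> length p \<le> 2 * n}"
      using length_le_endpoint[of p] by simp
  qed
  then show ?thesis
    using finite_lists_length_le[of "UNIV :: step set" "2 * n"] finite_subset by auto
qed

subsection \<open>Generating functions and Riordan arrays\<close>

text \<open>
  The coefficient of \<open>x ^ m\<close> in the \<open>k\<close>-th power of the Catalan generating function
  (\<open>k \<ge> 1\<close>). The prefactor is \<open>k / (2 * m + k)\<close>; equivalently
  \<open>C\<^sub>m\<^sup>(\<^sup>k\<^sup>) = k / (m + k) * ((2 * m + k - 1) choose m)\<close>.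
  The variant \<open>k / (m + k) * ((2 * m + k) choose m)\<close>, sometimes misprinted for it, is not an
  integer in general (\<open>15 / 4\<close> for \<open>k = 3\<close>, \<open>m = 1\<close>).
\<close>

definition catalan_conv :: "nat \<Rightarrow> nat \<Rightarrow> real" where
  "catalan_conv k m = real k / real (2 * m + k) * real ((2 * m + k) choose m)"

definition schroeder_fps :: "real fps" where
  "schroeder_fps =
     (1 - fps_X - fps_radical root 2 (1 - 6 * fps_X + fps_X ^ 2)) / (2 * fps_X)"

definition riordan_pair :: "real fps \<Rightarrow> real fps \<Rightarrow> bool" where
  "riordan_pair d h \<longleftrightarrow> d $ 0 = 1 \<and> h $ 0 = 0"

definition riordan_array :: "real fps \<Rightarrow> real fps \<Rightarrow> nat \<Rightarrow> nat \<Rightarrow> real" where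
  "riordan_array d h n i = (d * h ^ i) $ n"

text \<open>
  The quotient defining \<^const>\<open>schroeder_fps\<close> is exact, and the pair \<open>(S\<^sup>3 / (1 + x), x S\<^sup>2)\<close>
  satisfies the normalisation required of a Riordan array.
\<close>

lemma schroeder_fps_mult:
  "2 * fps_X * schroeder_fps =
     1 - fps_X - fps_radical root 2 (1 - 6 * fps_X + fps_X ^ 2)" (is "_ = ?N")
proof -
  have "?N $ 0 = 0" by simp
  then have "?N = fps_X * fps_shift 1 ?N"
    by (intro fps_ext) (auto simp del: fps_sub_nth)
  then obtain f where f: "?N = fps_X * f" by blast
  have "?N = 2 * fps_X * (fps_const (1 / 2) * f)"
    unfolding f by (simp add: fps_eq_iff numeral_fps_const mult.assoc fps_mult_left_const_nth)
  then have "2 * fps_X dvd ?N" by (rule dvdI)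
  then show ?thesis unfolding schroeder_fps_def by (rule dvd_mult_div_cancel)
qed

lemma schroeder_fps_equation:
  "fps_X * schroeder_fps ^ 2 - (1 - fps_X) * schroeder_fps + 1 = 0"
proof -
  let ?b = "1 - 6 * fps_X + fps_X ^ 2 :: real fps"
  have r: "fps_radical root 2 ?b ^ 2 = ?b"
    using power_radical[of ?b root 1] by (simp add: numeral_2_eq_2)
  have "fps_radical root 2 ?b = 1 - fps_X - 2 * fps_X * schroeder_fps"
    unfolding schroeder_fps_mult by simp
  with r have "(1 - fps_X - 2 * fps_X * schroeder_fps) ^ 2 = ?b" by simp
  then have "4 * fps_X * (fps_X * schroeder_fps ^ 2 - (1 - fps_X) * schroeder_fps + 1) = 0"
    by algebra
  then show ?thesis by simp
qed

lemma schroeder_fps_nth_0: "schroeder_fps $ 0 = 1"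
  using arg_cong[OF schroeder_fps_equation, of "\<lambda>f. f $ 0"] by simp

lemma riordan_pair_schroeder:
  "riordan_pair (schroeder_fps ^ 3 / (1 + fps_X)) (fps_X * schroeder_fps ^ 2)"
  by (simp add: riordan_pair_def fps_divide_unit fps_power_zeroth schroeder_fps_nth_0)

end

theory Submission
  imports Defs
begin

text \<open>
  A nonempty path either begins with a horizontal step or with an up step that is matched by the
  first return to the axis, through a down step or a vertical step. Iterating this decomposition
  identifies the paths with binary trees (\<open>bij_betw_tree_path\<close>). The pattern \<open>uvu\<close> can
  arise in only one way: an arch \<open>uv\<close> with nothing inside, followed by a path that begins with
  an up step. Avoidance and the number of up steps at a given level can therefore both be read off
  the tree.

  For any weight on trees the decomposition gives one functional equation
  (\<open>tree_gf_first_return\<close>). With the constant weight it becomes, after division by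
  \<open>1 + x\<close>, the quadratic equation of the large Schroeder series \<open>S\<close>, so \<open>S\<close> counts the
  avoiding paths. Let \<open>M\<^sub>i\<close> be the series whose weight is the number of up steps at level
  \<open>i + 1\<close>. An up step at level \<open>i + 2\<close> of an arch followed by a path is an up step at
  level \<open>i + 1\<close> of the interior of the arch or at level \<open>i + 2\<close> of the rest, so the
  equations for the \<open>M\<^sub>i\<close> are linear. Since \<open>1 - x - x S\<close> is the inverse of \<open>S\<close>, they
  solve to \<open>(1 + x) M\<^sub>0 = x S\<^sup>3\<close> and \<open>M\<^sub>i\<^sub>+\<^sub>1 = x S\<^sup>2 M\<^sub>i\<close>. Reading the coefficient of
  \<open>x\<^sup>n\<^sup>+\<^sup>1\<close> gives the entry of the Riordan array.

  For the double sum, the factor \<open>1 / (1 + x)\<close> contributes the alternating outer sum over the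
  coefficients of \<open>S\<^sup>2\<^sup>i\<^sup>+\<^sup>3\<close>. The inner sum is the coefficient of a power of \<open>S\<close>, in accordance
  with \<open>S(x) = C(y) / (1 - x)\<close> for \<open>y = x / (1 - x)\<^sup>2\<close> and the Catalan series \<open>C\<close>. It is
  verified without substitution of series: the equation \<open>S\<^sup>k\<^sup>+\<^sup>1 = x S\<^sup>k\<^sup>+\<^sup>1 + S\<^sup>k + x S\<^sup>k\<^sup>+\<^sup>2\<close> and
  the Pascal and ballot recurrences give both sides the same recursion.
\<close>

section \<open>Paths as first-return trees\<close>

datatype motzkin_tree =
    Empty
  | Flat motzkin_tree
  | Arch_Down motzkin_tree motzkin_tree
  | Arch_Vert motzkin_tree motzkin_tree

primrec tree_path :: "motzkin_tree \<Rightarrow> step list" where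
  "tree_path Empty = []"
| "tree_path (Flat t) = Horiz # tree_path t"
| "tree_path (Arch_Down a b) = Up # tree_path a @ Down # tree_path b"
| "tree_path (Arch_Vert a b) = Up # tree_path a @ Vert # tree_path b"

primrec width :: "motzkin_tree \<Rightarrow> nat" where
  "width Empty = 0"
| "width (Flat t) = Suc (width t)"
| "width (Arch_Down a b) = Suc (Suc (width a + width b))"
| "width (Arch_Vert a b) = Suc (width a + width b)"

primrec starts_up :: "motzkin_tree \<Rightarrow> bool" where
  "starts_up Empty = False"
| "starts_up (Flat t) = False"
| "starts_up (Arch_Down a b) = True"
| "starts_up (Arch_Vert a b) = True"

primrec tree_avoiding :: "motzkin_tree \<Rightarrow> bool" where
  "tree_avoiding Empty = True"
| "tree_avoiding (Flat t) = tree_avoiding t"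
| "tree_avoiding (Arch_Down a b) = (tree_avoiding a \<and> tree_avoiding b)"
| "tree_avoiding (Arch_Vert a b) =
     (tree_avoiding a \<and> tree_avoiding b \<and> \<not> (a = Empty \<and> starts_up b))"

text \<open>
  Levels are shifted so that \<open>up_count t i\<close> refers to up steps that start at height \<open>i\<close>: the
  first step of an arch is counted for \<open>i = 0\<close>, and descending into the arch lowers \<open>i\<close>.
\<close>

primrec up_count :: "motzkin_tree \<Rightarrow> nat \<Rightarrow> nat" where
  "up_count Empty i = 0"
| "up_count (Flat t) i = up_count t i"
| "up_count (Arch_Down a b) i = (case i of 0 \<Rightarrow> 1 | Suc j \<Rightarrow> up_count a j) + up_count b i"
| "up_count (Arch_Vert a b) i = (case i of 0 \<Rightarrow> 1 | Suc j \<Rightarrow> up_count a j) + up_count b i"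

definition avoiding_trees :: "nat \<Rightarrow> motzkin_tree set" where
  "avoiding_trees n = {t. tree_avoiding t \<and> width t = n}"

lemma endpoint_Nil [simp]: "endpoint [] = (0, 0)"
  by (simp add: endpoint_def zero_prod_def)

lemma endpoint_Cons [simp]: "endpoint (x # xs) = step_vec x + endpoint xs"
  by (simp add: endpoint_def)

lemma endpoint_append [simp]: "endpoint (xs @ ys) = endpoint xs + endpoint ys"
  by (simp add: endpoint_def)

lemma endpoint_tree_path [simp]: "endpoint (tree_path t) = (int (width t), 0)"
  by (induction t) auto

lemma fst_endpoint_nonneg: "0 \<le> fst (endpoint p)"
proof (induction p)
  case (Cons x p)
  then show ?case by (cases x) auto
qed simp

text \<open>
  The remainders may not be arbitrary, since a path followed by a path is again a path. A remainder
  that is empty or begins with a descending step marks where the height first drops below its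
  starting value, and this is also what follows the interior of an arch. Hence the induction
  hypothesis applies to the interior and yields the kind of descending step that closes the arch.
\<close>

lemma tree_path_unique_parse:
  assumes "tree_path t @ r = tree_path t' @ r'"
    and "r = [] \<or> hd r \<in> {Down, Vert}" and "r' = [] \<or> hd r' \<in> {Down, Vert}"
  shows "t = t' \<and> r = r'"
  using assms
proof (induction t arbitrary: t' r r')
  case Empty
  then show ?case by (cases t') auto
next
  case (Flat t)
  show ?case
  proof (cases t')
    case (Flat u)
    with Flat.prems Flat.IH[of r u r'] show ?thesis by auto
  qed (use Flat.prems in auto)
next
  case (Arch_Down a b)
  show ?case
  proof (cases t')
    case (Arch_Down a' b')
    with Arch_Down.prems have "a = a' \<and> Down # tree_path b @ r = Down # tree_path b' @ r'"
      by (intro Arch_Down.IH(1)) auto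
    with Arch_Down.prems Arch_Down.IH(2)[of r b' r'] Arch_Down show ?thesis by auto
  next
    case (Arch_Vert a' b')
    with Arch_Down.prems have "a = a' \<and> Down # tree_path b @ r = Vert # tree_path b' @ r'"
      by (intro Arch_Down.IH(1)) auto
    then show ?thesis by simp
  qed (use Arch_Down.prems in auto)
next
  case (Arch_Vert a b)
  show ?case
  proof (cases t')
    case (Arch_Vert a' b')
    with Arch_Vert.prems have "a = a' \<and> Vert # tree_path b @ r = Vert # tree_path b' @ r'"
      by (intro Arch_Vert.IH(1)) auto
    with Arch_Vert.prems Arch_Vert.IH(2)[of r b' r'] Arch_Vert show ?thesis by auto
  next
    case (Arch_Down a' b')
    with Arch_Vert.prems have "a = a' \<and> Vert # tree_path b @ r = Down # tree_path b' @ r'"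
      by (intro Arch_Vert.IH(1)) auto
    then show ?thesis by simp
  qed (use Arch_Vert.prems in auto)
qed

lemma inj_tree_path: "inj tree_path"
  by (rule injI) (use tree_path_unique_parse[of _ "[]" _ "[]"] in auto)

text \<open>
  A step sequence that ends at or below its starting height is a path up to the first moment, if
  any, at which it drops below that height. Allowing a remainder is what makes the induction work: after an initial
  up step the rest ends strictly below its start, so its remainder is nonempty and supplies the
  descending step that closes the arch.
\<close>

lemma exists_parse:
  assumes "snd (endpoint p) \<le> 0"
  shows "\<exists>t r. p = tree_path t @ r \<and> (r = [] \<or> hd r \<in> {Down, Vert})"
  using assms
proof (induction p rule: length_induct)
  case (1 p)
  show ?case
  proof (cases p)
    case Nil
    then have "p = tree_path Empty @ []" by simp
    then show ?thesis by blast
  next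
    case (Cons x q)
    show ?thesis
    proof (cases x)
      case Up
      then have "length q < length p" "snd (endpoint q) \<le> 0" using 1(2) Cons by simp_all
      then obtain a r where a: "q = tree_path a @ r" "r = [] \<or> hd r \<in> {Down, Vert}"
        using 1(1) by blast
      \<comment> \<open>The interior of the arch returns to height one, so the remainder must descend.\<close>
      have "snd (endpoint r) < 0" using 1(2) Cons Up a(1) by simp
      then have "r \<noteq> []" by auto
      then obtain c s where r: "r = c # s" by (cases r) auto
      with a(2) have c: "c = Down \<or> c = Vert" by simp
      then have "snd (endpoint s) \<le> 0"
        using \<open>snd (endpoint r) < 0\<close> r by auto
      moreover have "length s < length p" using Cons a r by simp
      ultimately obtain b r' where b: "s = tree_path b @ r'" "r' = [] \<or> hd r' \<in> {Down, Vert}"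
        using 1(1) by blast
      have "p = tree_path (Arch_Down a b) @ r' \<or> p = tree_path (Arch_Vert a b) @ r'"
        using Cons Up a(1) r b(1) c by auto
      with b(2) show ?thesis by blast
    next
      case Horiz
      then have "length q < length p" "snd (endpoint q) \<le> 0" using 1(2) Cons by simp_all
      then obtain t r where "q = tree_path t @ r" "r = [] \<or> hd r \<in> {Down, Vert}"
        using 1(1) by blast
      moreover from this have "p = tree_path (Flat t) @ r" using Cons Horiz by simp
      ultimately show ?thesis by blast
    next
      case Down
      then have "p = tree_path Empty @ p \<and> hd p \<in> {Down, Vert}" using Cons by simp
      then show ?thesis by blast
    next
      case Vert
      then have "p = tree_path Empty @ p \<and> hd p \<in> {Down, Vert}" using Cons by simp
      then show ?thesis by blast
    qed
  qed
qed

lemma arch_prefix_nonneg: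
  assumes "prefix q (Up # xs @ c # ys)" "endpoint xs = (w, 0)" "c = Down \<or> c = Vert"
    and xs: "\<And>q. prefix q xs \<Longrightarrow> 0 \<le> snd (endpoint q)"
    and ys: "\<And>q. prefix q ys \<Longrightarrow> 0 \<le> snd (endpoint q)"
  shows "0 \<le> snd (endpoint q)"
proof -
  consider "q = []" | r where "q = Up # r" "prefix r xs"
    | "q = Up # xs" | r where "q = Up # xs @ c # r" "prefix r ys"
    using assms(1) by (auto simp: prefix_Cons prefix_append)
  then show ?thesis
  proof cases
    case (2 r)
    then show ?thesis using xs[of r] by simp
  next
    case (4 r)
    then show ?thesis using ys[of r] assms(2,3) by auto
  qed (use assms(2) in auto)
qed

lemma tree_path_prefix_nonneg:
  "prefix q (tree_path t) \<Longrightarrow> 0 \<le> snd (endpoint q)"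
proof (induction t arbitrary: q)
  case (Flat t)
  then show ?case by (cases q) auto
next
  case (Arch_Down a b)
  then show ?case using arch_prefix_nonneg[of q "tree_path a" Down "tree_path b"] by simp
next
  case (Arch_Vert a b)
  then show ?case using arch_prefix_nonneg[of q "tree_path a" Vert "tree_path b"] by simp
qed auto

text \<open>
  When the path stays above the axis and ends on it, the remainder of the parse is empty, since its
  first step would lead to height \<open>-1\<close>.
\<close>

lemma G_Motzkin_path_iff_tree:
  "G_Motzkin_path n p \<longleftrightarrow> (\<exists>t. width t = n \<and> p = tree_path t)"
proof
  assume p: "G_Motzkin_path n p"
  then have e: "endpoint p = (int n, 0)" by (simp add: G_Motzkin_path_def)
  then obtain t r where t: "p = tree_path t @ r" "r = [] \<or> hd r \<in> {Down, Vert}"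
    using exists_parse[of p] by auto
  have "r = []"
  proof (rule ccontr)
    assume "r \<noteq> []"
    then obtain c s where r: "r = c # s" by (cases r) auto
    then have "take (Suc (length (tree_path t))) p = tree_path t @ [c]"
      using t(1) by simp
    moreover have "Suc (length (tree_path t)) \<le> length p" using t(1) r by simp
    then have "0 \<le> snd (endpoint (take (Suc (length (tree_path t))) p))"
      using p unfolding G_Motzkin_path_def by blast
    ultimately show False using t(2) r by auto
  qed
  with t(1) e show "\<exists>t. width t = n \<and> p = tree_path t" by auto
next
  assume "\<exists>t. width t = n \<and> p = tree_path t"
  then show "G_Motzkin_path n p"
    by (auto simp: G_Motzkin_path_def fst_endpoint_nonneg
        intro: tree_path_prefix_nonneg take_is_prefix)
qed

section \<open>Avoidance and levels read off the tree\<close>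

lemma last_tree_path: "tree_path t \<noteq> [] \<Longrightarrow> last (tree_path t) \<noteq> Up"
  by (induction t) (auto split: if_splits)

lemma tree_path_eq_Nil_iff [simp]: "tree_path t = [] \<longleftrightarrow> t = Empty"
  by (cases t) auto

lemma uvu_avoiding_Nil [simp]: "uvu_avoiding []"
  by (simp add: uvu_avoiding_def)

lemma uvu_avoiding_Cons:
  "uvu_avoiding (x # xs) \<longleftrightarrow> uvu_avoiding xs \<and> \<not> prefix [Up, Vert, Up] (x # xs)"
  by (auto simp: uvu_avoiding_def sublist_Cons_right)

text \<open>
  An occurrence of \<open>uvu\<close> that lies neither in \<open>xs\<close> nor in \<open>ys\<close> contains the step \<open>c\<close>. At an end \<open>c\<close> would be an up step, and in the middle the step before it would be
  one; both are excluded.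
\<close>

lemma uvu_avoiding_append_Cons:
  assumes "xs \<noteq> []" "last xs \<noteq> Up" "c \<noteq> Up"
  shows "uvu_avoiding (xs @ c # ys) \<longleftrightarrow> uvu_avoiding xs \<and> uvu_avoiding ys"
  using assms
proof (induction xs)
  case (Cons x xs)
  show ?case
  proof (cases xs)
    case Nil
    with Cons show ?thesis by (auto simp: uvu_avoiding_Cons)
  next
    case (Cons y zs)
    have "prefix [Up, Vert, Up] (x # xs @ c # ys) \<longleftrightarrow> prefix [Up, Vert, Up] (x # xs)"
      using Cons \<open>c \<noteq> Up\<close> by (cases zs) auto
    then show ?thesis
      using Cons Cons.IH Cons.prems by (auto simp: uvu_avoiding_Cons[of x])
  qed
qed simp

lemma starts_up_iff: "starts_up t \<longleftrightarrow> (\<exists>q. tree_path t = Up # q)"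
  by (cases t) auto

lemma uvu_avoiding_Up_tree_path:
  "uvu_avoiding (Up # tree_path t) \<longleftrightarrow> uvu_avoiding (tree_path t)"
  by (cases t) (auto simp: uvu_avoiding_Cons[of Up])

lemma uvu_avoiding_arch:
  assumes "c = Down \<or> c = Vert"
  shows "uvu_avoiding (Up # tree_path a @ c # tree_path b) \<longleftrightarrow>
    uvu_avoiding (tree_path a) \<and> uvu_avoiding (tree_path b) \<and>
    \<not> (c = Vert \<and> a = Empty \<and> starts_up b)"
proof (cases "a = Empty")
  case True
  then show ?thesis
    using assms by (cases b) (auto simp: uvu_avoiding_Cons[of Up] uvu_avoiding_Cons[of Vert]
      uvu_avoiding_Cons[of Down] starts_up_iff)
next
  case False
  then have "last (Up # tree_path a) \<noteq> Up" using last_tree_path by simp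
  then show ?thesis
    using uvu_avoiding_append_Cons[of "Up # tree_path a" c "tree_path b"] assms False
    by (auto simp: uvu_avoiding_Up_tree_path)
qed

lemma uvu_avoiding_tree_path: "uvu_avoiding (tree_path t) \<longleftrightarrow> tree_avoiding t"
  by (induction t) (simp_all add: uvu_avoiding_arch uvu_avoiding_Cons[of Horiz])

lemma bij_betw_tree_path: "bij_betw tree_path (avoiding_trees n) (G_uvu n)"
  unfolding bij_betw_def
proof
  show "inj_on tree_path (avoiding_trees n)"
    using inj_tree_path by (rule inj_on_subset) simp
  show "tree_path ` avoiding_trees n = G_uvu n"
    by (auto simp: avoiding_trees_def G_uvu_def G_Motzkin_path_iff_tree uvu_avoiding_tree_path)
qed

lemma finite_avoiding_trees: "finite (avoiding_trees n)"
  using bij_betw_finite[OF bij_betw_tree_path] finite_G_uvu by blast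

lemma u_steps_at_level_Nil [simp]: "u_steps_at_level l [] = {}"
  by (simp add: u_steps_at_level_def)

lemma finite_u_steps_at_level: "finite (u_steps_at_level l p)"
  by (simp add: u_steps_at_level_def)

lemma u_steps_at_level_Cons:
  "u_steps_at_level l (x # p) =
     (if x = Up \<and> l = 1 then {0} else {}) \<union>
     Suc ` u_steps_at_level (l - snd (step_vec x)) p" (is "?L = ?R")
proof (rule set_eqI)
  fix k show "k \<in> ?L \<longleftrightarrow> k \<in> ?R"
    by (cases k) (auto simp: u_steps_at_level_def)
qed

lemma card_u_steps_at_level_Cons:
  "card (u_steps_at_level l (x # p)) =
     (if x = Up \<and> l = 1 then 1 else 0) + card (u_steps_at_level (l - snd (step_vec x)) p)"
  unfolding u_steps_at_level_Cons
  by (subst card_Un_disjoint) (auto simp: finite_u_steps_at_level card_image)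

lemma card_u_steps_at_level_append:
  "card (u_steps_at_level l (p @ q)) =
     card (u_steps_at_level l p) + card (u_steps_at_level (l - snd (endpoint p)) q)"
  by (induction p arbitrary: l) (auto simp: card_u_steps_at_level_Cons algebra_simps)

text \<open>An up step starts at a nonnegative height, so it ends at a positive one.\<close>

lemma u_steps_at_level_nonpos:
  assumes "l \<le> 0"
  shows "u_steps_at_level l (tree_path t) = {}"
proof -
  have "l \<noteq> snd (endpoint (take (Suc k) (tree_path t)))"
    if k: "k < length (tree_path t)" "tree_path t ! k = Up" for k
  proof -
    have "0 \<le> snd (endpoint (take k (tree_path t)))"
      by (rule tree_path_prefix_nonneg) (rule take_is_prefix)
    then show ?thesis using k assms by (simp add: take_Suc_conv_app_nth)
  qed
  then show ?thesis by (auto simp: u_steps_at_level_def)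
qed

lemma card_u_steps_at_level_tree_path:
  "card (u_steps_at_level (int i + 1) (tree_path t)) = up_count t i"
  by (induction t arbitrary: i)
     (auto simp: card_u_steps_at_level_Cons card_u_steps_at_level_append u_steps_at_level_nonpos
        add.commute[of 1] split: nat.splits)

lemma U_eq_sum_up_count: "U n i = (\<Sum>t\<in>avoiding_trees (n + 1). up_count t i)"
  unfolding U_def
  by (simp add: sum.reindex_bij_betw[OF bij_betw_tree_path, symmetric]
      card_u_steps_at_level_tree_path)

section \<open>Weighted generating functions\<close>

definition tree_gf :: "(motzkin_tree \<Rightarrow> real) \<Rightarrow> real fps" where
  "tree_gf f = Abs_fps (\<lambda>n. \<Sum>t\<in>avoiding_trees n. f t)"

definition tree_pairs :: "nat \<Rightarrow> (motzkin_tree \<times> motzkin_tree) set" where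
  "tree_pairs n = (\<Union>k\<in>{0..n}. avoiding_trees k \<times> avoiding_trees (n - k))"

definition pair_gf :: "(motzkin_tree \<Rightarrow> motzkin_tree \<Rightarrow> real) \<Rightarrow> real fps" where
  "pair_gf f = Abs_fps (\<lambda>n. \<Sum>(a, b)\<in>tree_pairs n. f a b)"

lemma mem_tree_pairs:
  "(a, b) \<in> tree_pairs n \<longleftrightarrow> tree_avoiding a \<and> tree_avoiding b \<and> width a + width b = n"
  by (auto simp: tree_pairs_def avoiding_trees_def)

lemma finite_tree_pairs: "finite (tree_pairs n)"
  by (simp add: tree_pairs_def finite_avoiding_trees)

lemma tree_gf_add: "tree_gf (\<lambda>t. f t + g t) = tree_gf f + tree_gf g"
  by (simp add: fps_eq_iff tree_gf_def sum.distrib)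

lemma pair_gf_add: "pair_gf (\<lambda>a b. f a b + g a b) = pair_gf f + pair_gf g"
  by (simp add: fps_eq_iff pair_gf_def sum.distrib case_prod_unfold)

lemma pair_gf_mult: "pair_gf (\<lambda>a b. f a * g b) = tree_gf f * tree_gf g"
proof (rule fps_ext)
  fix n
  have "pair_gf (\<lambda>a b. f a * g b) $ n =
      (\<Sum>k = 0..n. \<Sum>(a, b)\<in>avoiding_trees k \<times> avoiding_trees (n - k). f a * g b)"
    unfolding pair_gf_def tree_pairs_def fps_nth_Abs_fps
    by (subst sum.UNION_disjoint) (auto simp: finite_avoiding_trees, auto simp: avoiding_trees_def)
  also have "\<dots> = (tree_gf f * tree_gf g) $ n"
    by (simp add: fps_mult_nth tree_gf_def sum_product sum.cartesian_product)
  finally show "pair_gf (\<lambda>a b. f a * g b) $ n = (tree_gf f * tree_gf g) $ n" .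
qed

lemma width_eq_0_iff: "width t = 0 \<longleftrightarrow> t = Empty"
  by (cases t) auto

lemma avoiding_trees_0: "avoiding_trees 0 = {Empty}"
  by (auto simp: avoiding_trees_def width_eq_0_iff)

text \<open>
  The trees that do not start with an up step are the empty one and those starting with a horizontal
  step, so the sum over the others is obtained by subtraction and keeps the form of a coefficient of
  generating functions.
\<close>

lemma sum_starts_up:
  "(\<Sum>t | t \<in> avoiding_trees n \<and> starts_up t. f t) =
     (tree_gf f - fps_const (f Empty) - fps_X * tree_gf (\<lambda>t. f (Flat t))) $ n"
proof (cases n)
  case 0
  then have none: "{t \<in> avoiding_trees n. starts_up t} = {}" by (auto simp: avoiding_trees_0)
  show ?thesis unfolding none by (simp add: 0 avoiding_trees_0 tree_gf_def)
next
  case (Suc m)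
  have *: "avoiding_trees n = {t \<in> avoiding_trees n. starts_up t} \<union> Flat ` avoiding_trees m"
  proof (rule set_eqI)
    fix t show "t \<in> avoiding_trees n \<longleftrightarrow>
      t \<in> {t \<in> avoiding_trees n. starts_up t} \<union> Flat ` avoiding_trees m"
      by (cases t) (auto simp: avoiding_trees_def Suc)
  qed
  have "sum f (avoiding_trees n) =
      sum f ({t \<in> avoiding_trees n. starts_up t} \<union> Flat ` avoiding_trees m)"
    using * by (rule arg_cong)
  also have "\<dots> =
      (\<Sum>t | t \<in> avoiding_trees n \<and> starts_up t. f t) + sum f (Flat ` avoiding_trees m)"
    by (rule sum.union_disjoint) (auto simp: finite_avoiding_trees)
  also have "sum f (Flat ` avoiding_trees m) = (\<Sum>t\<in>avoiding_trees m. f (Flat t))"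
    by (subst sum.reindex) (auto simp: inj_on_def)
  finally show ?thesis using Suc by (simp add: tree_gf_def)
qed

text \<open>
  The four summands correspond to the constructors. In the last one, the subtracted term removes the
  pairs that create the pattern \<open>uvu\<close>: an empty interior and a rest that starts with an up step.
  The weight is left arbitrary because the same equation is needed for counting paths and for
  counting up steps at every level.
\<close>

lemma tree_gf_first_return:
  "tree_gf f =
     fps_const (f Empty) + fps_X * tree_gf (\<lambda>t. f (Flat t))
     + fps_X * (fps_X * pair_gf (\<lambda>a b. f (Arch_Down a b)))
     + fps_X * (pair_gf (\<lambda>a b. f (Arch_Vert a b))
         - (tree_gf (\<lambda>b. f (Arch_Vert Empty b)) - fps_const (f (Arch_Vert Empty Empty))
              - fps_X * tree_gf (\<lambda>b. f (Arch_Vert Empty (Flat b)))))"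
proof (rule fps_ext, goal_cases)
  case (1 n)
  show ?case
  proof (cases n)
    case 0
    then show ?thesis by (simp add: tree_gf_def avoiding_trees_0)
  next
    case (Suc m)
    define D where "D = {(a, b). tree_avoiding a \<and> tree_avoiding b \<and> Suc (width a + width b) = m}"
    define B where "B = {b \<in> avoiding_trees m. starts_up b}"
    define V where "V = tree_pairs m - {Empty} \<times> B"
    have D: "D = (if m = 0 then {} else tree_pairs (m - 1))"
      by (auto simp: D_def mem_tree_pairs)
    have fin: "finite D" "finite B" "finite V"
      by (auto simp: D B_def V_def finite_tree_pairs finite_avoiding_trees)
    have mem_images:
      "Arch_Down a b \<in> (\<lambda>(a, b). Arch_Down a b) ` A \<longleftrightarrow> (a, b) \<in> A"
      "Arch_Vert a b \<in> (\<lambda>(a, b). Arch_Vert a b) ` A \<longleftrightarrow> (a, b) \<in> A" for a b A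
      by (auto intro: rev_image_eqI)
    have split: "avoiding_trees n = Flat ` avoiding_trees m \<union>
        ((\<lambda>(a, b). Arch_Down a b) ` D \<union> (\<lambda>(a, b). Arch_Vert a b) ` V)" (is "_ = ?R")
    proof (rule set_eqI)
      fix t show "t \<in> avoiding_trees n \<longleftrightarrow> t \<in> ?R"
        by (cases t)
           (auto simp: Suc avoiding_trees_def mem_images D_def V_def B_def mem_tree_pairs)
    qed
    have "tree_gf f $ n = sum f ?R"
      unfolding tree_gf_def fps_nth_Abs_fps split ..
    also have "\<dots> = sum f (Flat ` avoiding_trees m) +
        sum f ((\<lambda>(a, b). Arch_Down a b) ` D \<union> (\<lambda>(a, b). Arch_Vert a b) ` V)"
      by (rule sum.union_disjoint) (auto simp: fin finite_avoiding_trees)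
    also have "sum f ((\<lambda>(a, b). Arch_Down a b) ` D \<union> (\<lambda>(a, b). Arch_Vert a b) ` V) =
        sum f ((\<lambda>(a, b). Arch_Down a b) ` D) + sum f ((\<lambda>(a, b). Arch_Vert a b) ` V)"
      by (rule sum.union_disjoint) (auto simp: fin)
    also have "sum f (Flat ` avoiding_trees m) = tree_gf (\<lambda>t. f (Flat t)) $ m"
      by (subst sum.reindex) (auto simp: inj_on_def tree_gf_def)
    also have "sum f ((\<lambda>(a, b). Arch_Down a b) ` D) = (\<Sum>(a, b)\<in>D. f (Arch_Down a b))"
      by (subst sum.reindex) (auto simp: inj_on_def case_prod_unfold)
    also have "\<dots> = (fps_X * pair_gf (\<lambda>a b. f (Arch_Down a b))) $ m"
      by (simp add: D pair_gf_def)
    also have "sum f ((\<lambda>(a, b). Arch_Vert a b) ` V) = (\<Sum>(a, b)\<in>V. f (Arch_Vert a b))"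
      by (subst sum.reindex) (auto simp: inj_on_def case_prod_unfold)
    also have "\<dots> = (\<Sum>(a, b)\<in>tree_pairs m. f (Arch_Vert a b))
        - (\<Sum>(a, b)\<in>{Empty} \<times> B. f (Arch_Vert a b))"
      unfolding V_def
      by (rule sum_diff) (auto simp: finite_tree_pairs B_def mem_tree_pairs avoiding_trees_def)
    also have "(\<Sum>(a, b)\<in>{Empty} \<times> B. f (Arch_Vert a b)) = (\<Sum>b\<in>B. f (Arch_Vert Empty b))"
      by (simp flip: sum.cartesian_product)
    also have "\<dots> = (tree_gf (\<lambda>b. f (Arch_Vert Empty b)) - fps_const (f (Arch_Vert Empty Empty))
              - fps_X * tree_gf (\<lambda>b. f (Arch_Vert Empty (Flat b)))) $ m"
      unfolding B_def by (rule sum_starts_up)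
    finally show ?thesis by (simp add: Suc pair_gf_def)
  qed
qed

section \<open>Solving the first-return equations\<close>

abbreviation path_gf :: "real fps" where
  "path_gf \<equiv> tree_gf (\<lambda>_. 1)"

abbreviation up_gf :: "nat \<Rightarrow> real fps" where
  "up_gf i \<equiv> tree_gf (\<lambda>t. real (up_count t i))"

text \<open>
  The second root of the quadratic is not a power series: the difference of the two equations is
  \<open>f - g\<close> times a series with constant term \<open>-1\<close>.
\<close>

lemma fps_quadratic_unique:
  fixes f g :: "real fps"
  assumes "fps_X * f ^ 2 - (1 - fps_X) * f + 1 = 0"
    and "fps_X * g ^ 2 - (1 - fps_X) * g + 1 = 0"
  shows "f = g"
proof -
  have "(f - g) * (fps_X * (f + g) - (1 - fps_X)) =
      (fps_X * f ^ 2 - (1 - fps_X) * f + 1) - (fps_X * g ^ 2 - (1 - fps_X) * g + 1)"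
    by (simp add: algebra_simps power2_eq_square)
  then have "(f - g) * (fps_X * (f + g) - (1 - fps_X)) = 0"
    using assms by simp
  moreover have "fps_X * (f + g) - (1 - fps_X) \<noteq> 0"
  proof
    assume "fps_X * (f + g) - (1 - fps_X) = 0"
    from arg_cong[OF this, of "\<lambda>h. h $ 0"] show False by simp
  qed
  ultimately show ?thesis by simp
qed

lemma one_plus_X_neq_0: "(1 + fps_X :: real fps) \<noteq> 0"
proof
  assume "(1 + fps_X :: real fps) = 0"
  from arg_cong[OF this, of "\<lambda>h. h $ 0"] show False by simp
qed

text \<open>
  The two kinds of arches contribute the factor \<open>x + x\<^sup>2 = x (1 + x)\<close>, and the correction for
  \<open>uvu\<close> turns the remaining terms into multiples of \<open>1 + x\<close> too. What is left after
  cancellation is the equation of the Schroeder series.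
\<close>

lemma path_gf_eq_schroeder: "path_gf = schroeder_fps"
proof -
  have "pair_gf (\<lambda>a b. 1) = path_gf * path_gf"
    using pair_gf_mult[of "\<lambda>_. 1" "\<lambda>_. 1"] by simp
  then have rec: "path_gf = 1 + fps_X * path_gf + fps_X * (fps_X * (path_gf * path_gf))
      + fps_X * (path_gf * path_gf - (path_gf - 1 - fps_X * path_gf))"
    using tree_gf_first_return[of "\<lambda>_. 1"] by simp
  have "(1 + fps_X) * (fps_X * path_gf ^ 2 - (1 - fps_X) * path_gf + 1) =
      (1 + fps_X * path_gf + fps_X * (fps_X * (path_gf * path_gf))
        + fps_X * (path_gf * path_gf - (path_gf - 1 - fps_X * path_gf))) - path_gf"
    by (simp add: algebra_simps power2_eq_square)
  also have "\<dots> = 0"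
    unfolding rec[symmetric] by simp
  finally have "(1 + fps_X) * (fps_X * path_gf ^ 2 - (1 - fps_X) * path_gf + 1) = 0" .
  then have "fps_X * path_gf ^ 2 - (1 - fps_X) * path_gf + 1 = 0"
    using one_plus_X_neq_0 by simp
  then show ?thesis
    using schroeder_fps_equation by (rule fps_quadratic_unique)
qed

lemma schroeder_fps_inverse: "schroeder_fps * (1 - fps_X - fps_X * schroeder_fps) = 1"
proof -
  have "schroeder_fps * (1 - fps_X - fps_X * schroeder_fps) =
      1 - (fps_X * schroeder_fps ^ 2 - (1 - fps_X) * schroeder_fps + 1)"
    by (simp add: algebra_simps power2_eq_square)
  then show ?thesis by (simp add: schroeder_fps_equation)
qed

text \<open>
  The equation for the first level is linear in the unknown, with coefficient
  \<open>(1 + x) (1 - x - x S) = (1 + x) / S\<close> and right-hand side \<open>x S\<^sup>2\<close>.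
\<close>

lemma up_gf_0: "(1 + fps_X) * up_gf 0 = fps_X * schroeder_fps ^ 3"
proof -
  let ?S = schroeder_fps and ?M = "up_gf 0"
  have pair: "pair_gf (\<lambda>a b. 1 + real (up_count b 0)) = ?S * ?S + ?S * ?M"
    using pair_gf_add[of "\<lambda>a b. 1 * 1" "\<lambda>a b. 1 * real (up_count b 0)"]
      pair_gf_mult[of "\<lambda>_. 1" "\<lambda>_. 1"] pair_gf_mult[of "\<lambda>_. 1" "\<lambda>b. real (up_count b 0)"]
    by (simp add: path_gf_eq_schroeder)
  have single: "tree_gf (\<lambda>b. 1 + real (up_count b 0)) = ?S + ?M"
    by (simp add: tree_gf_add path_gf_eq_schroeder)
  have rec: "?M = fps_X * ?M + fps_X * (fps_X * (?S * ?S + ?S * ?M))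
      + fps_X * (?S * ?S + ?S * ?M - (?S + ?M - 1 - fps_X * (?S + ?M)))"
    using tree_gf_first_return[of "\<lambda>t. real (up_count t 0)"] by (simp add: pair single)
  have "(1 + fps_X) * (1 - fps_X - fps_X * ?S) * ?M
        - (fps_X * ?S ^ 2 + fps_X * (fps_X * ?S ^ 2 - (1 - fps_X) * ?S + 1)) =
      ?M - (fps_X * ?M + fps_X * (fps_X * (?S * ?S + ?S * ?M))
        + fps_X * (?S * ?S + ?S * ?M - (?S + ?M - 1 - fps_X * (?S + ?M))))"
    by (simp add: algebra_simps power2_eq_square)
  then have linear: "(1 + fps_X) * (1 - fps_X - fps_X * ?S) * ?M = fps_X * ?S ^ 2"
    unfolding rec[symmetric] schroeder_fps_equation by simp
  have "(1 + fps_X) * (?S * (1 - fps_X - fps_X * ?S)) * ?M = fps_X * ?S ^ 3"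
    using arg_cong[OF linear, of "\<lambda>f. ?S * f"]
    by (simp add: mult_ac power2_eq_square power3_eq_cube)
  then show ?thesis by (simp add: schroeder_fps_inverse)
qed

text \<open>
  Here an arch with empty interior contributes nothing from its interior, so the correction for
  \<open>uvu\<close> involves only the series itself. The coefficient of the unknown is again
  \<open>(1 + x) / S\<close>, and now the inhomogeneous term also carries a factor \<open>1 + x\<close>, which cancels.
\<close>

lemma up_gf_Suc: "up_gf (Suc i) = fps_X * schroeder_fps ^ 2 * up_gf i"
proof -
  let ?S = schroeder_fps and ?M = "up_gf i" and ?N = "up_gf (Suc i)"
  have pair: "pair_gf (\<lambda>a b. real (up_count a i) + real (up_count b (Suc i))) = ?M * ?S + ?S * ?N"
    using pair_gf_add[of "\<lambda>a b. real (up_count a i) * 1" "\<lambda>a b. 1 * real (up_count b (Suc i))"]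
      pair_gf_mult[of "\<lambda>a. real (up_count a i)" "\<lambda>_. 1"]
      pair_gf_mult[of "\<lambda>_. 1" "\<lambda>b. real (up_count b (Suc i))"]
    by (simp add: path_gf_eq_schroeder)
  have rec: "?N = fps_X * ?N + fps_X * (fps_X * (?M * ?S + ?S * ?N))
      + fps_X * (?M * ?S + ?S * ?N - (?N - fps_X * ?N))"
    using tree_gf_first_return[of "\<lambda>t. real (up_count t (Suc i))"] by (simp add: pair)
  have "(1 + fps_X) * (1 - fps_X - fps_X * ?S) * ?N - (1 + fps_X) * fps_X * ?S * ?M =
      ?N - (fps_X * ?N + fps_X * (fps_X * (?M * ?S + ?S * ?N))
        + fps_X * (?M * ?S + ?S * ?N - (?N - fps_X * ?N)))"
    by (simp add: algebra_simps)
  then have linear: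
    "(1 + fps_X) * (1 - fps_X - fps_X * ?S) * ?N = (1 + fps_X) * fps_X * ?S * ?M"
    unfolding rec[symmetric] by simp
  have "(1 + fps_X) * ((?S * (1 - fps_X - fps_X * ?S)) * ?N) =
      (1 + fps_X) * (fps_X * ?S ^ 2 * ?M)"
    using arg_cong[OF linear, of "\<lambda>f. ?S * f"] by (simp only: mult_ac power2_eq_square)
  then have "(1 + fps_X) * ?N = (1 + fps_X) * (fps_X * ?S ^ 2 * ?M)"
    by (simp add: schroeder_fps_inverse)
  then show ?thesis using one_plus_X_neq_0 by simp
qed

lemma up_gf_eq:
  "up_gf i = fps_X * (schroeder_fps ^ 3 / (1 + fps_X) * (fps_X * schroeder_fps ^ 2) ^ i)"
proof (induction i)
  case 0
  have "(1 + fps_X) * (schroeder_fps ^ 3 / (1 + fps_X)) = schroeder_fps ^ 3"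
    by (rule dvd_mult_div_cancel) (simp add: fps_is_unit_iff unit_imp_dvd)
  then have "(1 + fps_X) * up_gf 0 = (1 + fps_X) * (fps_X * (schroeder_fps ^ 3 / (1 + fps_X)))"
    unfolding up_gf_0 by (metis mult.left_commute)
  then show ?case using one_plus_X_neq_0 by simp
next
  case (Suc i)
  then show ?case by (simp add: up_gf_Suc mult_ac)
qed

lemma U_eq_riordan_array:
  "real (U n i) =
     riordan_array (schroeder_fps ^ 3 / (1 + fps_X)) (fps_X * schroeder_fps ^ 2) n i"
proof -
  have "real (U n i) = up_gf i $ (n + 1)"
    by (simp add: U_eq_sum_up_count tree_gf_def)
  also have "\<dots> = riordan_array (schroeder_fps ^ 3 / (1 + fps_X)) (fps_X * schroeder_fps ^ 2) n i"
    unfolding up_gf_eq riordan_array_def by simp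
  finally show ?thesis .
qed

section \<open>Coefficients of the powers of the Schroeder series\<close>

text \<open>
  The coefficient of \<open>x\<^sup>n\<close> in the series with summands
  \<open>catalan_conv k m \<cdot> x\<^sup>m / (1 - x)\<^sup>2\<^sup>m\<^sup>+\<^sup>k\<close>, which is the \<open>k\<close>-th power of
  \<open>C(x / (1 - x)\<^sup>2) / (1 - x)\<close> for \<open>k > 0\<close> and the Catalan series \<open>C\<close>.
\<close>

definition schroeder_conv :: "nat \<Rightarrow> nat \<Rightarrow> real" where
  "schroeder_conv k n =
     (\<Sum>m\<le>n. real ((n + m + k - 1) choose (n - m)) * catalan_conv k m)"

text \<open>
  This is the coefficient form of \<open>C\<^sup>k\<^sup>+\<^sup>1 = C\<^sup>k + x C\<^sup>k\<^sup>+\<^sup>2\<close>, that is, of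
  \<open>C = 1 + x C\<^sup>2\<close>. All three terms are rational multiples of the binomial coefficient \<open>b\<close>.
\<close>

lemma catalan_conv_rec:
  "catalan_conv (Suc k) (Suc m) = catalan_conv k (Suc m) + catalan_conv (Suc (Suc k)) m"
proof -
  define s where "s = 2 * m + k + 2"
  define b where "b = real (s choose m)"
  have b1: "real (s choose Suc m) = b * (real m + real k + 2) / (real m + 1)"
  proof -
    have "Suc m * (s choose Suc m) = (s - m) * (s choose m)"
      using binomial_absorption[of m s] binomial_absorb_comp[of s m] by simp
    then have "real (Suc m) * real (s choose Suc m) = real (s - m) * b"
      unfolding b_def by (metis of_nat_mult)
    then show ?thesis by (simp add: s_def field_simps)
  qed
  have b2: "real (Suc s choose Suc m) = b * (2 * real m + real k + 3) / (real m + 1)"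
    by (simp add: b1 field_simps flip: b_def)
  have "catalan_conv (Suc k) (Suc m) = (real k + 1) / (real s + 1) * real (Suc s choose Suc m)"
    by (simp add: catalan_conv_def s_def algebra_simps)
  moreover have "catalan_conv k (Suc m) = real k / real s * real (s choose Suc m)"
    by (simp add: catalan_conv_def s_def algebra_simps)
  moreover have "catalan_conv (Suc (Suc k)) m = (real k + 2) / real s * b"
    by (simp add: catalan_conv_def s_def b_def algebra_simps)
  moreover have "(real k + 1) / (real s + 1) * (b * (2 * real m + real k + 3) / (real m + 1))
      = real k / real s * (b * (real m + real k + 2) / (real m + 1)) + (real k + 2) / real s * b"
  proof -
    have s: "real s = 2 * real m + real k + 2" by (simp add: s_def)
    have "real m + 1 \<noteq> 0" "2 * real m + real k + 2 \<noteq> 0" "2 * real m + real k + 3 \<noteq> 0"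
      by linarith+
    then show ?thesis unfolding s by (simp add: divide_simps) algebra
  qed
  ultimately show ?thesis by (simp only: b1 b2)
qed

text \<open>
  One of the two halves from Pascal's rule gives the first summand on the right; the other is split
  by the recurrence for the Catalan numbers into the remaining two.
\<close>

lemma schroeder_conv_rec:
  "schroeder_conv (Suc k) (Suc n) =
     schroeder_conv (Suc k) n + schroeder_conv k (Suc n) + schroeder_conv (Suc (Suc k)) n"
proof -
  let ?c = catalan_conv and ?B = "\<lambda>m. real ((n + m + k) choose (Suc n - m))"
  have pascal: "real (Suc (n + m + k) choose (Suc n - m)) =
      real ((n + m + k) choose (n - m)) + ?B m" if "m \<le> n" for m
    using that by (simp add: Suc_diff_le algebra_simps)
  have "schroeder_conv (Suc k) (Suc n) =
      (\<Sum>m\<le>n. real (Suc (n + m + k) choose (Suc n - m)) * ?c (Suc k) m) + ?c (Suc k) (Suc n)"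
    by (simp add: schroeder_conv_def)
  also have "(\<Sum>m\<le>n. real (Suc (n + m + k) choose (Suc n - m)) * ?c (Suc k) m) =
      schroeder_conv (Suc k) n + (\<Sum>m\<le>n. ?B m * ?c (Suc k) m)"
    unfolding schroeder_conv_def sum.distrib[symmetric]
    by (rule sum.cong) (simp_all add: pascal distrib_right)
  also have "\<dots> + ?c (Suc k) (Suc n) =
      schroeder_conv (Suc k) n + (\<Sum>m\<le>Suc n. ?B m * ?c (Suc k) m)"
    by simp
  also have "(\<Sum>m\<le>Suc n. ?B m * ?c (Suc k) m) =
      ?B 0 * ?c (Suc k) 0 + (\<Sum>m\<le>n. ?B (Suc m) * ?c (Suc k) (Suc m))"
    by (rule sum.atMost_Suc_shift)
  \<comment> \<open>For \<open>k = 0\<close> the Catalan factors differ (the default \<open>0 / 0 = 0\<close>), but then \<open>?B 0\<close> is zero.\<close>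
  also have "?B 0 * ?c (Suc k) 0 = ?B 0 * ?c k 0"
    by (cases k) (simp_all add: catalan_conv_def)
  also have "(\<Sum>m\<le>n. ?B (Suc m) * ?c (Suc k) (Suc m)) =
      (\<Sum>m\<le>n. ?B (Suc m) * ?c k (Suc m)) + (\<Sum>m\<le>n. ?B (Suc m) * ?c (Suc (Suc k)) m)"
    by (simp add: catalan_conv_rec distrib_left sum.distrib)
  also have "(\<Sum>m\<le>n. ?B (Suc m) * ?c (Suc (Suc k)) m) = schroeder_conv (Suc (Suc k)) n"
    by (simp add: schroeder_conv_def)
  also have "?B 0 * ?c k 0 + ((\<Sum>m\<le>n. ?B (Suc m) * ?c k (Suc m))
      + schroeder_conv (Suc (Suc k)) n) =
      (\<Sum>m\<le>Suc n. ?B m * ?c k m) + schroeder_conv (Suc (Suc k)) n"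
    by (simp only: sum.atMost_Suc_shift add.assoc)
  also have "(\<Sum>m\<le>Suc n. ?B m * ?c k m) = schroeder_conv k (Suc n)"
    by (simp add: schroeder_conv_def)
  finally show ?thesis by simp
qed

lemma schroeder_power_rec:
  "(schroeder_fps ^ Suc k) $ Suc n =
     (schroeder_fps ^ Suc k) $ n + (schroeder_fps ^ k) $ Suc n + (schroeder_fps ^ Suc (Suc k)) $ n"
proof -
  have "schroeder_fps ^ Suc k =
      fps_X * schroeder_fps ^ Suc k + schroeder_fps ^ k + fps_X * schroeder_fps ^ Suc (Suc k)"
    using arg_cong[OF schroeder_fps_equation, of "\<lambda>f. f * schroeder_fps ^ k"]
    by (simp add: algebra_simps power2_eq_square)
  from arg_cong[OF this, of "\<lambda>f. f $ Suc n"] show ?thesis by simp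
qed

text \<open>
  The two recursions agree and determine the values by induction on \<open>n\<close> and, for fixed \<open>n\<close>, on
  \<open>k\<close>. The excluded corner is a genuine exception: \<open>schroeder_conv 0 0\<close> is zero by the convention
  for division by zero, while \<open>S\<^sup>0\<close> has constant term one.
\<close>

lemma schroeder_power_nth:
  assumes "0 < k \<or> 0 < n"
  shows "(schroeder_fps ^ k) $ n = schroeder_conv k n"
  using assms
proof (induction n arbitrary: k)
  case 0
  then show ?case
    by (simp add: schroeder_conv_def catalan_conv_def fps_power_zeroth schroeder_fps_nth_0)
next
  case (Suc n)
  note IH = Suc.IH
  show ?case
  proof (induction k)
    case 0
    have "schroeder_conv 0 (Suc n) = 0"
      unfolding schroeder_conv_def by (rule sum.neutral) (simp add: catalan_conv_def)
    then show ?case by simp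
  next
    case (Suc k)
    with IH show ?case
      unfolding schroeder_power_rec schroeder_conv_rec by (simp del: power_Suc)
  qed
qed

text \<open>
  The powers of \<open>x S\<^sup>2\<close> only shift and raise the exponent of \<open>S\<close>; the alternating sum is
  multiplication by the geometric series \<open>1 / (1 + x)\<close>.
\<close>

lemma riordan_array_eq_sum:
  assumes "i \<le> n"
  shows "riordan_array (schroeder_fps ^ 3 / (1 + fps_X)) (fps_X * schroeder_fps ^ 2) n i =
    (\<Sum>j = 0..n - i. (-1) ^ j * (schroeder_fps ^ (2 * i + 3)) $ (n - i - j))"
proof -
  have "schroeder_fps ^ 3 / (1 + fps_X) * (fps_X * schroeder_fps ^ 2) ^ i =
      fps_X ^ i * (inverse (1 + fps_X) * schroeder_fps ^ (2 * i + 3))"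
    by (simp add: fps_divide_unit power_mult_distrib power_add mult_ac flip: power_mult)
  then have "riordan_array (schroeder_fps ^ 3 / (1 + fps_X)) (fps_X * schroeder_fps ^ 2) n i =
      (inverse (1 + fps_X) * schroeder_fps ^ (2 * i + 3)) $ (n - i)"
    using assms by (simp add: riordan_array_def fps_X_power_mult_nth)
  then show ?thesis
    by (simp add: fps_inverse_fps_X_plus1 fps_mult_nth)
qed

theorem theorem4p1:
  fixes n i :: nat
  assumes "i \<le> n"
  shows "real (U n i) =
           (\<Sum>j = 0..n - i. (-1) ^ j *
              (\<Sum>m = 0..n - i - j.
                 real ((n + m + i + 2 - j) choose (n - i - j - m)) * catalan_conv (2 * i + 3) m))
         \<and> real (U n i) =
           riordan_array (schroeder_fps ^ 3 / (1 + fps_X)) (fps_X * schroeder_fps ^ 2) n i"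
proof
  have "(schroeder_fps ^ (2 * i + 3)) $ (n - i - j) =
      (\<Sum>m = 0..n - i - j.
         real ((n + m + i + 2 - j) choose (n - i - j - m)) * catalan_conv (2 * i + 3) m)"
    if "j \<le> n - i" for j
  proof -
    have "n - i - j + m + (2 * i + 3) - 1 = n + m + i + 2 - j" for m
      using that assms by simp
    then show ?thesis
      by (simp add: schroeder_power_nth schroeder_conv_def atMost_atLeast0)
  qed
  then show "real (U n i) =
           (\<Sum>j = 0..n - i. (-1) ^ j *
              (\<Sum>m = 0..n - i - j.
                 real ((n + m + i + 2 - j) choose (n - i - j - m)) * catalan_conv (2 * i + 3) m))"
    unfolding U_eq_riordan_array riordan_array_eq_sum[OF assms] by simp
  show "real (U n i) =
      riordan_array (schroeder_fps ^ 3 / (1 + fps_X)) (fps_X * schroeder_fps ^ 2) n i"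
    by (rule U_eq_riordan_array)
qed

end
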